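(* Let $G$ be a finite non-abelian group of even order and let $t$ be a non-central element of $G$ such that $t^2$ is central (that is, $t \in G \setminus Z(G)$ and $t^2 \in Z(G)$). Then there exists a non-central element $x$ of $G$ (that is, $x \in G \setminus Z(G)$) such that $$|G| \le |C_G(t)|^2 \left( |C_G(x)| - \frac{1}{2} \right).$$
   Context: $Z(G)$ denotes the center of $G$, and for $y \in G$, $C_G(y) = \{g \in G : gy = yg\}$ denotes the centralizer of $y$ in $G$. The inequality is between real (rational) numbers. *)

theory Defs
  imports Complex_Main "HOL-Algebra.Coset"
begin

definition center :: "('a, 'b) monoid_scheme \<Rightarrow> 'a set"
  where "center G = {z \<in> carrier G. \<forall>g \<in> carrier G. z \<otimes>\<^bsub>G\<^esub> g = g \<otimes>\<^bsub>G\<^esub> z}"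

definition centralizer :: "('a, 'b) monoid_scheme \<Rightarrow> 'a \<Rightarrow> 'a set"
  where "centralizer G y = {g \<in> carrier G. g \<otimes>\<^bsub>G\<^esub> y = y \<otimes>\<^bsub>G\<^esub> g}"

end

theory Submission
  imports Defs "HOL-Algebra.Group_Action"
begin

text \<open>
  A Brauer--Fowler count of the pairs $(a, b)$ of conjugates of $t$ according to $x = a b^{-1}$.
  All conjugates of $t$ have the same central square, so $a$ inverts $x$, and hence at most
  $|C_G(x)|$ pairs lie over $x$. The sum of $|C_G(x)|$ over the non-central $x$ is $r |G|$ with
  $r$ the number of non-central classes; if $c$ is the largest of these $|C_G(x)|$ then every
  such class has at least $|G|/c$ elements, so that $r < c$ and thus $r \le c - 1$. The central
  $x$ are absorbed by the remaining half because $2 |Z(G)| \le |C_G(t)|$.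
\<close>

context group
begin

text \<open>Restricted to the carrier because group actions consist of extensional maps;
  \<open>action_by_conjugation\<close> then applies verbatim.\<close>

abbreviation conj_act :: "'a \<Rightarrow> 'a \<Rightarrow> 'a"
  where "conj_act \<equiv> \<lambda>g. \<lambda>h \<in> carrier G. g \<otimes> h \<otimes> inv g"

lemma center_carrier: "z \<in> center G \<Longrightarrow> z \<in> carrier G"
  by (simp add: center_def)

lemma center_commute: "z \<in> center G \<Longrightarrow> g \<in> carrier G \<Longrightarrow> z \<otimes> g = g \<otimes> z"
  by (simp add: center_def)

lemma stabilizer_conj_act:
  assumes "x \<in> carrier G"
  shows "stabilizer G conj_act x = centralizer G x"
proof -
  have "g \<otimes> x \<otimes> inv g = x \<longleftrightarrow> g \<otimes> x = x \<otimes> g" if "g \<in> carrier G" for g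
    using that assms by (metis inv_solve_right' m_closed)
  then show ?thesis
    using assms by (auto simp: stabilizer_def centralizer_def)
qed

lemma card_class_mult_card_centralizer:
  assumes "x \<in> carrier G"
  shows "card (orbit G conj_act x) * card (centralizer G x) = order G"
  using group_action.orbit_stabilizer_theorem[OF action_by_conjugation assms]
  by (simp add: stabilizer_conj_act[OF assms])

text \<open>By orbit-stabilizer each conjugacy class contributes exactly |G| to the sum over the
  whole carrier. Each central element also contributes |G|, so removing the center leaves a multiple
  of |G|.\<close>

lemma order_dvd_sum_card_centralizer:
  assumes "finite (carrier G)"
  shows "order G dvd (\<Sum>x \<in> carrier G - center G. card (centralizer G x))"
proof -
  interpret group_action G "carrier G" conj_act
    by (rule action_by_conjugation)
  have sub: "center G \<subseteq> carrier G"
    by (auto simp: center_def)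
  have "(\<Sum>x \<in> carrier G. card (centralizer G x)) = (\<Sum>x \<in> carrier G. card (stabilizer G conj_act x))"
    by (intro sum.cong) (simp_all add: stabilizer_conj_act)
  also have "\<dots> = (\<Sum>orb \<in> orbits G (carrier G) conj_act. \<Sum>x \<in> orb. card (stabilizer G conj_act x))"
    by (rule disjoint_sum[OF assms, symmetric])
  also have "\<dots> = (\<Sum>orb \<in> orbits G (carrier G) conj_act. order G)"
    by (intro sum.cong refl card_stablizer_sum assms)
  finally have all: "order G dvd (\<Sum>x \<in> carrier G. card (centralizer G x))"
    by simp
  have "centralizer G x = carrier G" if "x \<in> center G" for x
    using that by (auto simp: center_def centralizer_def)
  then have central: "order G dvd (\<Sum>x \<in> center G. card (centralizer G x))"
    by (simp add: order_def)
  show ?thesis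
    using all central sum.subset_diff[OF sub assms, of "\<lambda>x. card (centralizer G x)"]
    by (simp add: dvd_add_left_iff)
qed

lemma one_in_center: "\<one> \<in> center G"
  by (simp add: center_def)

text \<open>Since \<open>\<one>\<close> is central, there are fewer than |G| summands, each at most
  \<open>c\<close>, so the sum is strictly below |G| c. Being a multiple of |G|, it drops by a full
  |G|.\<close>

lemma sum_card_centralizer_le:
  assumes fin: "finite (carrier G)"
    and c: "\<And>x. x \<in> carrier G - center G \<Longrightarrow> card (centralizer G x) \<le> c"
    and c0: "0 < c"
  shows "(\<Sum>x \<in> carrier G - center G. card (centralizer G x)) \<le> order G * (c - 1)"
proof -
  let ?S = "\<Sum>x \<in> carrier G - center G. card (centralizer G x)"
  obtain r where r: "?S = order G * r"
    using order_dvd_sum_card_centralizer[OF fin] by (elim dvdE)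
  have "card (carrier G - center G) < order G"
    unfolding order_def using one_in_center by (intro psubset_card_mono fin) auto
  moreover have "?S \<le> card (carrier G - center G) * c"
    using sum_bounded_above[of "carrier G - center G" "\<lambda>x. card (centralizer G x)" c] c by simp
  ultimately have "order G * r < order G * c"
    using r c0 by (metis le_less_trans mult_less_mono1)
  then have "r \<le> c - 1"
    by auto
  then show ?thesis
    using r by simp
qed

text \<open>The cosets Z(G) and t Z(G) are disjoint, of equal size, and both lie in the centralizer
  of \<open>t\<close>.\<close>

lemma two_card_center_le:
  assumes fin: "finite (carrier G)" and t: "t \<in> carrier G - center G"
  shows "2 * card (center G) \<le> card (centralizer G t)"
proof -
  have "inj_on (\<lambda>z. t \<otimes> z) (center G)"
    using t center_carrier by (auto intro!: inj_onI)
  then have img: "card ((\<lambda>z. t \<otimes> z) ` center G) = card (center G)"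
    by (rule card_image)
  have "t \<otimes> z \<notin> center G" if z: "z \<in> center G" for z
  proof
    assume tz: "t \<otimes> z \<in> center G"
    \<comment> \<open>If t z were central, cancelling the central factor \<open>z\<close> would make
      \<open>t\<close> central.\<close>
    have "t \<otimes> g = g \<otimes> t" if g: "g \<in> carrier G" for g
    proof -
      have "(t \<otimes> g) \<otimes> z = (t \<otimes> z) \<otimes> g"
        using t z g center_carrier center_commute by (simp add: m_assoc)
      also have "\<dots> = g \<otimes> (t \<otimes> z)"
        using tz g by (rule center_commute)
      also have "\<dots> = (g \<otimes> t) \<otimes> z"
        using t z g center_carrier by (simp add: m_assoc)
      finally show ?thesis
        using t z g center_carrier by simp
    qed
    then show False
      using t by (simp add: center_def)
  qed
  then have disj: "center G \<inter> (\<lambda>z. t \<otimes> z) ` center G = {}"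
    by auto
  have "center G \<union> (\<lambda>z. t \<otimes> z) ` center G \<subseteq> centralizer G t"
    using t by (auto simp: centralizer_def center_def m_assoc)
  moreover have "finite (centralizer G t)" "finite (center G)"
    using fin by (simp_all add: centralizer_def center_def)
  ultimately show ?thesis
    using img disj by (metis card_Un_disjoint card_mono finite_imageI mult_2)
qed

lemma conjugate_square:
  assumes t: "t \<in> carrier G" and sq: "t \<otimes> t \<in> center G" and a: "a \<in> orbit G conj_act t"
  shows "a \<in> carrier G" "a \<otimes> a = t \<otimes> t"
proof -
  obtain g where g: "g \<in> carrier G" and ag: "a = g \<otimes> t \<otimes> inv g"
    using a t by (auto simp: orbit_def)
  show "a \<in> carrier G"
    using g t ag by simp
  have "a \<otimes> a = g \<otimes> (t \<otimes> t) \<otimes> inv g"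
    using g t ag by (simp add: m_assoc inv_solve_left')
  \<comment> \<open>Conjugation fixes the central element \<open>t \<otimes> t\<close>.\<close>
  also have "\<dots> = t \<otimes> t"
    using g t center_commute[OF sq g] by (metis inv_solve_right' m_closed)
  finally show "a \<otimes> a = t \<otimes> t" .
qed

text \<open>From a^2 = b^2 follows b^-1 a = b a^-1, which is x^-1; hence x a = a (b^-1 a) = a
  x^-1.\<close>

lemma inverted_by_left_factor:
  assumes a: "a \<in> carrier G" and b: "b \<in> carrier G" and eq: "a \<otimes> a = b \<otimes> b"
    and x: "x = a \<otimes> inv b"
  shows "x \<otimes> a = a \<otimes> inv x"
proof -
  have "inv x = b \<otimes> inv a"
    using a b x by (simp add: inv_mult_group)
  moreover have "inv b \<otimes> a = b \<otimes> inv a"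
    using a b eq by (metis inv_closed inv_solve_left inv_solve_right m_assoc m_closed)
  ultimately show ?thesis
    using a b x by (simp add: m_assoc)
qed

text \<open>A pair in the fibre is determined by its first entry, which gives the bound by
  \<open>card T\<close>, used for central \<open>x\<close>. Every first entry inverts
  \<open>x\<close>, and two elements inverting \<open>x\<close> differ by an element centralizing
  it, which gives the other bound.\<close>

lemma card_quotient_fibre_le:
  assumes fin: "finite (carrier G)" and T: "T \<subseteq> carrier G"
    and sq: "\<And>a b. a \<in> T \<Longrightarrow> b \<in> T \<Longrightarrow> a \<otimes> a = b \<otimes> b"
    and x: "x \<in> carrier G"
  defines "F \<equiv> {p \<in> T \<times> T. fst p \<otimes> inv (snd p) = x}"
  shows "card F \<le> card T" "card F \<le> card (centralizer G x)"
proof -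
  have inj: "inj_on fst F"
  proof (rule inj_onI)
    fix p q assume pq: "p \<in> F" "q \<in> F" "fst p = fst q"
    then have carr: "fst q \<in> carrier G" "snd p \<in> carrier G" "snd q \<in> carrier G"
      using T by (auto simp: F_def)
    have "fst q \<otimes> inv (snd p) = fst q \<otimes> inv (snd q)"
      using pq by (simp add: F_def)
    then have "snd p = snd q"
      using carr inv_inj by (simp add: inj_on_eq_iff)
    then show "p = q"
      using pq(3) by (simp add: prod_eq_iff)
  qed
  have "finite T"
    using T fin finite_subset by blast
  then show "card F \<le> card T"
    by (rule card_inj_on_le[OF inj, rotated]) (auto simp: F_def)
  show "card F \<le> card (centralizer G x)"
  proof (cases "F = {}")
    case False
    then obtain p where p: "p \<in> F"
      by blast
    have inverts: "fst q \<in> carrier G \<and> x \<otimes> fst q = fst q \<otimes> inv x" if "q \<in> F" for q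
    proof -
      have "fst q \<in> T" "snd q \<in> T" "x = fst q \<otimes> inv (snd q)"
        using that by (auto simp: F_def)
      then show ?thesis
        using T sq[of "fst q" "snd q"] inverted_by_left_factor[of "fst q" "snd q" x] by blast
    qed
    define a where "a = fst p"
    have a: "a \<in> carrier G" "x \<otimes> a = a \<otimes> inv x"
      using inverts[OF p] by (simp_all add: a_def)
    \<comment> \<open>Conjugation by \<open>e\<close> and by \<open>inv a\<close> each inverts
      \<open>x\<close>, so their composite fixes it.\<close>
    have "inv a \<otimes> e \<otimes> x = x \<otimes> (inv a \<otimes> e)"
      if e: "e \<in> carrier G" "x \<otimes> e = e \<otimes> inv x" for e
    proof -
      have "e \<otimes> x = inv x \<otimes> e"
        using e x by (metis inv_closed inv_inv inv_solve_left inv_solve_right m_assoc m_closed)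
      moreover have "inv a \<otimes> inv x = x \<otimes> inv a"
        using a x by (metis inv_closed inv_inv inv_mult_group)
      ultimately have "inv a \<otimes> (e \<otimes> x) = (x \<otimes> inv a) \<otimes> e"
        using a(1) x e(1) by (simp add: m_assoc flip: \<open>inv a \<otimes> inv x = x \<otimes> inv a\<close>)
      then show ?thesis
        using a(1) x e(1) by (simp add: m_assoc)
    qed
    then have maps: "(\<lambda>q. inv a \<otimes> fst q) ` F \<subseteq> centralizer G x"
      using inverts a by (auto simp: centralizer_def)
    have "inj_on (\<lambda>q. inv a \<otimes> fst q) F"
      using inj inverts a by (auto simp: inj_on_def)
    then show ?thesis
      using maps fin by (intro card_inj_on_le) (auto simp: centralizer_def)
  qed simp
qed

text \<open>The fibres of (a, b) \<mapsto> a b^-1 cover \<open>T \<times> T\<close>. Over central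
  \<open>x\<close> the centralizer is all of \<open>G\<close>, so the bound \<open>card T\<close> is
  taken there instead.\<close>

lemma card_square_le:
  assumes fin: "finite (carrier G)" and T: "T \<subseteq> carrier G"
    and sq: "\<And>a b. a \<in> T \<Longrightarrow> b \<in> T \<Longrightarrow> a \<otimes> a = b \<otimes> b"
  shows "card T * card T
    \<le> card T * card (center G) + (\<Sum>x \<in> carrier G - center G. card (centralizer G x))"
proof -
  let ?F = "\<lambda>x. {p \<in> T \<times> T. fst p \<otimes> inv (snd p) = x}"
  have sub: "center G \<subseteq> carrier G"
    by (auto simp: center_def)
  have "T \<times> T = (\<Union>x \<in> carrier G. ?F x)"
    using T by (auto simp: subset_iff)
  then have "card T * card T \<le> (\<Sum>x \<in> carrier G. card (?F x))"
    using card_UN_le[OF fin, of ?F] by (simp add: card_cartesian_product[symmetric])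
  also have "\<dots> = (\<Sum>x \<in> carrier G - center G. card (?F x)) + (\<Sum>x \<in> center G. card (?F x))"
    by (rule sum.subset_diff[OF sub fin])
  also have "\<dots> \<le> (\<Sum>x \<in> carrier G - center G. card (centralizer G x)) + (\<Sum>x \<in> center G. card T)"
    using card_quotient_fibre_le[OF fin T sq] sub by (intro add_mono sum_mono) auto
  finally show ?thesis
    by (simp add: mult.commute add.commute)
qed

end

theorem theorem2:
  fixes G :: "('a, 'b) monoid_scheme" (structure) and t :: 'a
  assumes "group G"
    and "finite (carrier G)"
    and "\<not> comm_group G"
    and "even (order G)"
    and "t \<in> carrier G - center G"
    and "t [^] (2::nat) \<in> center G"
  shows "\<exists>x \<in> carrier G - center G.
    real (order G) \<le> (real (card (centralizer G t)))\<^sup>2 * (real (card (centralizer G x)) - 1 / 2)"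
proof -
  interpret group G by fact
  note fin = assms(2) and t = assms(5)
  let ?N = "carrier G - center G"
  define T where "T = orbit G conj_act t"
  define m where "m = card T"
  define k where "k = card (centralizer G t)"
  \<comment> \<open>The witness \<open>x\<close> is a non-central element attaining this maximum;
    \<open>t\<close> shows that the set is nonempty.\<close>
  define c where "c = Max ((\<lambda>x. card (centralizer G x)) ` ?N)"
  have "c \<in> (\<lambda>x. card (centralizer G x)) ` ?N"
    unfolding c_def using fin t by (intro Max_in) auto
  then obtain x where x: "x \<in> ?N" "card (centralizer G x) = c"
    by auto
  have cmax: "card (centralizer G y) \<le> c" if "y \<in> ?N" for y
    unfolding c_def using fin that by (intro Max_ge) auto
  have mk: "m * k = order G"
    using card_class_mult_card_centralizer t by (simp add: m_def k_def T_def)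
  have "0 < order G"
    using fin order_gt_0_iff_finite by blast
  then have m0: "0 < m" and k0: "0 < k"
    using mk by (metis mult_0 gr0I, metis mult_0_right gr0I)
  have c0: "0 < c"
    using cmax[OF t] k0 by (simp add: k_def)
  have sq: "t \<otimes> t \<in> center G"
    using assms(6) t by (simp add: numeral_2_eq_2)
  have "m * m \<le> m * card (center G) + (\<Sum>x \<in> ?N. card (centralizer G x))"
    unfolding m_def T_def using conjugate_square[OF _ sq] t by (intro card_square_le fin) auto
  also have "\<dots> \<le> m * card (center G) + m * k * (c - 1)"
    using sum_card_centralizer_le[OF fin cmax c0] mk by simp
  also have "\<dots> = m * (card (center G) + k * (c - 1))"
    by (simp add: algebra_simps)
  \<comment> \<open>One factor \<open>m\<close> cancels because |G| = m k.\<close>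
  finally have "m \<le> card (center G) + k * (c - 1)"
    using m0 by simp
  \<comment> \<open>Source of the 1/2: |Z(G)| is at most k/2, and k/2 + k (c - 1) = k (c - 1/2).
    Doubling keeps the estimate in the naturals.\<close>
  then have "2 * m \<le> k + 2 * (k * (c - 1))"
    using two_card_center_le[OF fin t] by (simp add: k_def)
  then have "real (2 * m) \<le> real (k + 2 * (k * (c - 1)))"
    by (simp only: of_nat_le_iff)
  \<comment> \<open>Positivity of \<open>c\<close> makes the truncated \<open>c - 1\<close> agree
    with real subtraction.\<close>
  then have "real m \<le> real k * (real c - 1 / 2)"
    using c0 by (simp add: of_nat_diff algebra_simps)
  \<comment> \<open>The extra factor \<open>k\<close> turns the class size \<open>m\<close> into |G|
    and squares \<open>k\<close> on the right.\<close>
  then have "real m * real k \<le> real k * (real c - 1 / 2) * real k"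
    by (rule mult_right_mono) simp
  then have "real (order G) \<le> (real k)\<^sup>2 * (real c - 1 / 2)"
    by (simp add: mk[symmetric] power2_eq_square algebra_simps)
  then show ?thesis
    using x unfolding k_def by blast
qed

end
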